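(* Let $n,m\ge1$ and let $\mathcal{I}=\{I_r\}_{r=1}^n$ and $\mathcal{J}=\{J_s\}_{s=1}^m$ be sets of intervals of $\mathbb{R}^2$, where each $I_r$ is a $(p_r,q_r)$-interval and each $J_s$ is a $(p'_s,q'_s)$-interval with $p_r,q_r,p'_s,q'_s$ positive integers. (i) We have $$\hat d(\mathcal{I},\mathcal{J})=\max\Big(\max_r\big(\min_s\epsilon_{rs}\big),\ \max_s\big(\min_r\epsilon_{rs}\big)\Big),$$ where $\epsilon_{rs}=\max\big(\max_k a_k,\max_l b_l,\max_i a'_i,\max_j b'_j\big)$ and, writing $\min(I_r)=\{(x^r_i,y^r_i)\}_{i=1}^{p_r}$, $\max(I_r)=\{(X^r_j,Y^r_j)\}_{j=1}^{q_r}$, $\min(J_s)=\{(x^s_k,y^s_k)\}_{k=1}^{p'_s}$, $\max(J_s)=\{(X^s_l,Y^s_l)\}_{l=1}^{q'_s}$, $$a_k=\min_i\max\big((1-\delta(x^r_i,x^s_k))|x^s_k-x^r_i|,\ (1-\delta(y^r_i,y^s_k))|y^s_k-y^r_i|\big),$$ $$b_l=\min_j\max\big(\delta(X^r_j,X^s_l)|X^s_l-X^r_j|,\ \delta(Y^r_j,Y^s_l)|Y^s_l-Y^r_j|\big),$$ $$a'_i=\min_k\max\big((1-\delta(x^s_k,x^r_i))|x^r_i-x^s_k|,\ (1-\delta(y^s_k,y^r_i))|y^r_i-y^s_k|\big),$$ $$b'_j=\min_l\max\big(\delta(X^s_l,X^r_j)|X^r_j-X^s_l|,\ \delta(Y^s_l,Y^r_j)|Y^r_j-Y^s_l|\big).$$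 (ii) If $\mathcal{I}$ and $\mathcal{J}$ consist solely of $(1,1)$- or $(2,1)$-intervals, and $I_r$, $J_s$ have parameters $(x_1,y_1,a,b,c,d)$ and $(x_2,y_2,e,f,g,h)$ respectively, then $\epsilon_{rs}$ is the maximum of the following four quantities: $$H\big(F(x_2-f,x_1-b,y_2,y_1),\,F(x_2-f,x_1,y_2,y_1-c),\,F(x_2,x_1-b,y_2-g,y_1),\,F(x_2,x_1,y_2-g,y_1-c)\big),$$ $$F(x_1+d,\,x_2+h,\,y_1+a,\,y_2+e),$$ $$H\big(F(x_1-b,x_2-f,y_1,y_2),\,F(x_1-b,x_2,y_1,y_2-g),\,F(x_1,x_2-f,y_1-c,y_2),\,F(x_1,x_2,y_1-c,y_2-g)\big),$$ $$F(x_2+h,\,x_1+d,\,y_2+e,\,y_1+a).$$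
   Context: $\mathbb{R}^2$ carries the product partial order. An interval of $\mathbb{R}^2$ is a nonempty subset $I$ that is convex ($p,q\in I$, $p\le r\le q$ imply $r\in I$) and connected (any two elements are joined by a finite sequence in $I$ whose consecutive terms are comparable). $\min(I)$ and $\max(I)$ are the sets of minimal and maximal elements of $I$. A $(p,q)$-interval is an interval with exactly $p$ minimal points and exactly $q$ maximal points, and it is understood to be determined by them: $I=\{z\in\mathbb{R}^2:\exists u\in\min(I),\exists v\in\max(I),\ u\le z\le v\}$. For $\epsilon\ge0$, $I^\epsilon=\{q\in\mathbb{R}^2:\exists p\in I,\ \|p-q\|_\infty\le\epsilon\}$. An $\epsilon$-correspondence between nonempty sets of intervals $\mathcal{I},\mathcal{J}$ is a subset $\mathcal{R}\subset\mathcal{I}\times\mathcal{J}$ with surjective projections to both factors such that $J\subset I^\epsilon$ and $I\subset J^\epsilon$ for all $(I,J)\in\mathcal{R}$. Define $\hat d(\mathcal{I},\mathcal{J}):=\inf\{\epsilon>0:\text{there exists an }\epsilon\text{-correspondence between }\mathcal{I}\text{ and }\mathcal{J}\}$. For real $x,y$: $\delta(x,y)=1$ if $x\le y$ and $\delta(x,y)=0$ if $x>y$. For real arguments, $F(w_1,w_2,w_3,w_4):=\max\big(\delta(w_1,w_2)|w_2-w_1|,\ \delta(w_3,w_4)|w_4-w_3|\big)$ and $H(o_1,o_2,o_3,o_4):=\max\big(\min(o_1,o_2),\min(o_3,o_4)\big)$. Parameters of $(1,1)$- and $(2,1)$-intervals: a $(2,1)$-interval with minimal points $(\xi_1,\eta_1),(\xi_2,\eta_2)$,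 $\xi_1<\xi_2$, $\eta_1>\eta_2$, and maximal point $(X,Y)$ has parameters $(x,y,a,b,c,d)=(\xi_2,\ \eta_1,\ Y-\eta_1,\ \xi_2-\xi_1,\ \eta_1-\eta_2,\ X-\xi_2)$; thus its minimal points are $(x-b,y)$ and $(x,y-c)$ and its maximal point is $(x+d,y+a)$. A $(1,1)$-interval with minimal point $(\xi,\eta)$ and maximal point $(X,Y)$ has parameters $(\xi,\eta,Y-\eta,0,0,X-\xi)$. *)

theory Defs
  imports "HOL-Analysis.Analysis"
begin

text \<open>
  The order on \<^typ>\<open>real \<times> real\<close> is the componentwise one (\<^theory>\<open>HOL-Library.Product_Order\<close>).
\<close>

definition order_convex :: "'a::order set \<Rightarrow> bool" where
  "order_convex I \<longleftrightarrow> (\<forall>p\<in>I. \<forall>q\<in>I. \<forall>r. p \<le> r \<and> r \<le> q \<longrightarrow> r \<in> I)"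

definition order_connected :: "'a::order set \<Rightarrow> bool" where
  "order_connected I \<longleftrightarrow>
     (\<forall>p\<in>I. \<forall>q\<in>I. (p, q) \<in> {(u, v). u \<in> I \<and> v \<in> I \<and> (u \<le> v \<or> v \<le> u)}\<^sup>*)"

definition poset_interval :: "'a::order set \<Rightarrow> bool" where
  "poset_interval I \<longleftrightarrow> I \<noteq> {} \<and> order_convex I \<and> order_connected I"

definition min_points :: "'a::order set \<Rightarrow> 'a set" where
  "min_points I = {u \<in> I. \<forall>v\<in>I. v \<le> u \<longrightarrow> v = u}"

definition max_points :: "'a::order set \<Rightarrow> 'a set" where
  "max_points I = {u \<in> I. \<forall>v\<in>I. u \<le> v \<longrightarrow> v = u}"

definition pq_interval :: "nat \<Rightarrow> nat \<Rightarrow> (real \<times> real) set \<Rightarrow> bool" where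
  "pq_interval p q I \<longleftrightarrow> poset_interval I \<and>
     finite (min_points I) \<and> card (min_points I) = p \<and>
     finite (max_points I) \<and> card (max_points I) = q \<and>
     I = {z. \<exists>u\<in>min_points I. \<exists>v\<in>max_points I. u \<le> z \<and> z \<le> v}"

text \<open>
  The norm of \<^typ>\<open>real \<times> real\<close> is Euclidean; the sup norm is \<^const>\<open>infnorm\<close>.
\<close>

definition thickening :: "(real \<times> real) set \<Rightarrow> real \<Rightarrow> (real \<times> real) set" where
  "thickening I \<epsilon> = {q. \<exists>p\<in>I. infnorm (p - q) \<le> \<epsilon>}"

definition eps_correspondence ::
  "real \<Rightarrow> (real \<times> real) set set \<Rightarrow> (real \<times> real) set set \<Rightarrow>
     ((real \<times> real) set \<times> (real \<times> real) set) set \<Rightarrow> bool" where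
  "eps_correspondence \<epsilon> \<I> \<J> R \<longleftrightarrow> R \<subseteq> \<I> \<times> \<J> \<and> fst ` R = \<I> \<and> snd ` R = \<J> \<and>
     (\<forall>(I, J)\<in>R. J \<subseteq> thickening I \<epsilon> \<and> I \<subseteq> thickening J \<epsilon>)"

text \<open>
  Extended-real valued, so that the infimum of the empty set is \<^term>\<open>\<infinity> :: ereal\<close>.
\<close>

definition d_hat :: "(real \<times> real) set set \<Rightarrow> (real \<times> real) set set \<Rightarrow> ereal" where
  "d_hat \<I> \<J> = (INF \<epsilon>\<in>{\<epsilon>. \<epsilon> > 0 \<and> (\<exists>R. eps_correspondence \<epsilon> \<I> \<J> R)}. ereal \<epsilon>)"

definition \<delta> :: "real \<Rightarrow> real \<Rightarrow> real" where
  "\<delta> x y = (if x \<le> y then 1 else 0)"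

text \<open>
  The quantities \<open>a\<^sub>k\<close> and \<open>b\<^sub>l\<close>: the second argument of \<open>min_defect I\<close> is the \<open>k\<close>-th minimal
  point of \<open>J\<close>, that of \<open>max_defect I\<close> the \<open>l\<close>-th maximal point of \<open>J\<close>. Exchanging the roles
  of \<open>I\<close> and \<open>J\<close> gives \<open>a'\<^sub>i\<close> and \<open>b'\<^sub>j\<close>. Minima and maxima range over the (finite) sets of
  minimal and maximal points themselves instead of over an enumeration of them.
\<close>

definition min_defect :: "(real \<times> real) set \<Rightarrow> real \<times> real \<Rightarrow> real" where
  "min_defect I = (\<lambda>(x', y'). Min ((\<lambda>(x, y).
     max ((1 - \<delta> x x') * \<bar>x' - x\<bar>) ((1 - \<delta> y y') * \<bar>y' - y\<bar>)) ` min_points I))"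

definition max_defect :: "(real \<times> real) set \<Rightarrow> real \<times> real \<Rightarrow> real" where
  "max_defect I = (\<lambda>(X', Y'). Min ((\<lambda>(X, Y).
     max (\<delta> X X' * \<bar>X' - X\<bar>) (\<delta> Y Y' * \<bar>Y' - Y\<bar>)) ` max_points I))"

definition interval_eps :: "(real \<times> real) set \<Rightarrow> (real \<times> real) set \<Rightarrow> real" where
  "interval_eps I J = Max {
     MAX v\<in>min_points J. min_defect I v,
     MAX v\<in>max_points J. max_defect I v,
     MAX u\<in>min_points I. min_defect J u,
     MAX u\<in>max_points I. max_defect J u}"

definition F :: "real \<Rightarrow> real \<Rightarrow> real \<Rightarrow> real \<Rightarrow> real" where
  "F w1 w2 w3 w4 = max (\<delta> w1 w2 * \<bar>w2 - w1\<bar>) (\<delta> w3 w4 * \<bar>w4 - w3\<bar>)"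

definition H :: "real \<Rightarrow> real \<Rightarrow> real \<Rightarrow> real \<Rightarrow> real" where
  "H o1 o2 o3 o4 = max (min o1 o2) (min o3 o4)"

text \<open>
  In both cases the minimal points are \<open>(x - b, y)\<close> and \<open>(x, y - c)\<close>, which coincide for
  \<open>b = c = 0\<close>, and the maximal point is \<open>(x + d, y + a)\<close>.
\<close>

inductive has_params ::
  "(real \<times> real) set \<Rightarrow> real \<Rightarrow> real \<Rightarrow> real \<Rightarrow> real \<Rightarrow> real \<Rightarrow> real \<Rightarrow> bool" where
  one_one: "pq_interval 1 1 I \<Longrightarrow> min_points I = {(\<xi>, \<eta>)} \<Longrightarrow> max_points I = {(X, Y)} \<Longrightarrow>
    has_params I \<xi> \<eta> (Y - \<eta>) 0 0 (X - \<xi>)"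
| two_one: "pq_interval 2 1 I \<Longrightarrow> min_points I = {(\<xi>\<^sub>1, \<eta>\<^sub>1), (\<xi>\<^sub>2, \<eta>\<^sub>2)} \<Longrightarrow> \<xi>\<^sub>1 < \<xi>\<^sub>2 \<Longrightarrow> \<eta>\<^sub>1 > \<eta>\<^sub>2 \<Longrightarrow>
    max_points I = {(X, Y)} \<Longrightarrow>
    has_params I \<xi>\<^sub>2 \<eta>\<^sub>1 (Y - \<eta>\<^sub>1) (\<xi>\<^sub>2 - \<xi>\<^sub>1) (\<eta>\<^sub>1 - \<eta>\<^sub>2) (X - \<xi>\<^sub>2)"

end

theory Submission
  imports Defs
begin

text \<open>
  Everything rests on one fact about the plane: a convex connected set \<open>I\<close> meets the square of
  radius \<open>\<epsilon>\<close> around \<open>q\<close> as soon as it has one point below the top corner of that square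
  and one point above its bottom corner; the two points need not be comparable
  (\<open>interval_meets_box\<close>). So whether \<open>q\<close> lies in \<open>I\<^sup>\<epsilon>\<close> is decided by the minimal and by the
  maximal points of \<open>I\<close> separately. Since each point of \<open>J\<close> lies between a minimal and a maximal
  point of \<open>J\<close>, the inclusion of \<open>J\<close> in \<open>I\<^sup>\<epsilon>\<close> need only be tested at the extremal points of \<open>J\<close>,
  where it says that the \<open>a\<^sub>k\<close> and \<open>b\<^sub>l\<close> are at most \<open>\<epsilon>\<close> (\<open>subset_thickening_iff\<close>). Hence
  \<^term>\<open>interval_eps I J\<close> is the least \<open>\<epsilon> \<ge> 0\<close> for which \<open>I\<close> and \<open>J\<close> may be paired, and an
  \<open>\<epsilon>\<close>-correspondence exists iff every interval on either side has a partner at cost at most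
  \<open>\<epsilon>\<close>, which is a lower bound on \<open>\<epsilon>\<close>.

  The second part only rewrites \<^const>\<open>interval_eps\<close> for at most two minimal points and one
  maximal point. Both the defects and the function \<^const>\<open>F\<close> are instances of one asymmetric
  distance between points (\<open>excess\<close>), and \<^const>\<open>H\<close> is the resulting maximum of minima.
\<close>

section \<open>Convex connected sets and boxes\<close>

text \<open>
  Walk in \<open>I\<close> from \<open>u\<close> to \<open>v\<close>, keeping track of a point \<open>a \<le> t\<close> of \<open>I\<close> with \<open>a \<le> sup p b\<close>
  for the current point \<open>p\<close>. Once \<open>b \<le> p\<close>, this says \<open>a \<le> p\<close>, and then \<open>sup a b\<close> is both
  between \<open>a\<close> and \<open>p\<close> and in the box. Dimension two enters through the points \<open>p\<close> with neither
  \<open>p \<le> t\<close> nor \<open>b \<le> p\<close>: they form two quadrants, beyond the upper left and the lower right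
  corner, which no comparability joins.
\<close>

lemma interval_meets_box:
  fixes I :: "('a::{linorder,lattice} \<times> 'b::{linorder,lattice}) set"
  assumes conv: "order_convex I" and conn: "order_connected I" and bt: "b \<le> t"
    and u: "u \<in> I" "u \<le> t" and v: "v \<in> I" "b \<le> v"
  shows "\<exists>p\<in>I. b \<le> p \<and> p \<le> t"
proof (rule ccontr)
  assume disj: "\<not> ?thesis"
  have apart: False if "a \<in> I" "a \<le> t" "p \<in> I" "b \<le> p" "a \<le> p" for a p
  proof -
    have "sup a b \<in> I"
      using conv that unfolding order_convex_def by (metis le_sup_iff order_refl sup.cobounded1)
    then show False
      using disj that bt by (meson le_sup_iff sup.cobounded2)
  qed
  have "(u, v) \<in> {(p, q). p \<in> I \<and> q \<in> I \<and> (p \<le> q \<or> q \<le> p)}\<^sup>*"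
    using conn u v unfolding order_connected_def by blast
  then have "v \<in> I \<and> (\<exists>a\<in>I. a \<le> t \<and> a \<le> sup v b)"
  proof (induction rule: rtrancl_induct)
    case base
    then show ?case using u by (auto intro: le_supI1)
  next
    case (step p q)
    then obtain a where pq: "p \<in> I" "q \<in> I" "p \<le> q \<or> q \<le> p"
      and a: "a \<in> I" "a \<le> t" "a \<le> sup p b" by blast
    have npb: "\<not> b \<le> p"
      using apart[OF a(1,2) pq(1)] a(3) by (auto simp: sup_absorb1)
    consider "p \<le> q" | "q \<le> t" | "q \<le> p" "\<not> q \<le> t" using pq by blast
    then show ?case
    proof cases
      case 1
      then have "a \<le> sup q b" using a(3) by (meson order_trans sup_mono order_refl)
      then show ?thesis using pq a by blast
    next
      case 2
      then show ?thesis using pq by (auto intro: le_supI1)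
    next
      case 3
      \<comment> \<open>One coordinate of \<open>q\<close> exceeds that of \<open>t\<close>, hence so does that of \<open>p\<close>; by \<open>npb\<close> the
        other coordinate of \<open>p\<close> is below that of \<open>b\<close>, so \<open>a\<close> still serves for \<open>q\<close>.\<close>
      then have "a \<le> sup q b"
        using a(2,3) npb bt unfolding less_eq_prod_def fst_sup snd_sup sup_max
        by (auto simp: le_max_iff_disj)
      then show ?thesis using pq a by blast
    qed
  qed
  then show False
    using apart[of _ v] v by (auto simp: sup_absorb1)
qed

section \<open>Thickenings\<close>

lemma infnorm_prod_real: "infnorm (p :: real \<times> real) = max \<bar>fst p\<bar> \<bar>snd p\<bar>"
  unfolding infnorm_Max
  by (simp add: Basis_prod_def image_Un image_image inner_prod_def max.commute)

lemma infnorm_le_iff: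
  fixes p q :: "real \<times> real"
  shows "infnorm (p - q) \<le> \<epsilon> \<longleftrightarrow> q - (\<epsilon>, \<epsilon>) \<le> p \<and> p \<le> q + (\<epsilon>, \<epsilon>)"
  by (auto simp: infnorm_prod_real less_eq_prod_def)

lemma mem_thickening_iff:
  assumes "poset_interval I" "\<epsilon> \<ge> 0"
  shows "q \<in> thickening I \<epsilon> \<longleftrightarrow> (\<exists>u\<in>I. u \<le> q + (\<epsilon>, \<epsilon>)) \<and> (\<exists>v\<in>I. q \<le> v + (\<epsilon>, \<epsilon>))"
proof -
  have shift: "q - (\<epsilon>, \<epsilon>) \<le> p \<longleftrightarrow> q \<le> p + (\<epsilon>, \<epsilon>)" for p
    by (auto simp: less_eq_prod_def)
  have "q - (\<epsilon>, \<epsilon>) \<le> q + (\<epsilon>, \<epsilon>)"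
    using assms by (simp add: less_eq_prod_def)
  then show ?thesis
    using assms interval_meets_box[of I "q - (\<epsilon>, \<epsilon>)" "q + (\<epsilon>, \<epsilon>)"]
    unfolding thickening_def poset_interval_def infnorm_le_iff mem_Collect_eq shift by blast
qed

lemma pq_interval_bounds:
  assumes "pq_interval p q I" "z \<in> I"
  shows "\<exists>u\<in>min_points I. u \<le> z" "\<exists>v\<in>max_points I. z \<le> v"
  using assms unfolding pq_interval_def by blast+

lemma pq_interval_extremal_points:
  assumes "pq_interval p q I"
  shows "finite (min_points I)" "min_points I \<noteq> {}" "finite (max_points I)" "max_points I \<noteq> {}"
    "min_points I \<subseteq> I" "max_points I \<subseteq> I"
  using assms unfolding pq_interval_def poset_interval_def min_points_def max_points_def
  by blast+

lemma mem_thickening_pq_interval_iff: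
  assumes I: "pq_interval p q I" and "\<epsilon> \<ge> 0"
  shows "z \<in> thickening I \<epsilon> \<longleftrightarrow>
    (\<exists>u\<in>min_points I. u \<le> z + (\<epsilon>, \<epsilon>)) \<and> (\<exists>v\<in>max_points I. z \<le> v + (\<epsilon>, \<epsilon>))"
proof -
  have "poset_interval I" using I by (simp add: pq_interval_def)
  moreover have "(\<exists>u\<in>I. u \<le> z + (\<epsilon>, \<epsilon>)) \<longleftrightarrow> (\<exists>u\<in>min_points I. u \<le> z + (\<epsilon>, \<epsilon>))"
    using pq_interval_bounds(1)[OF I] pq_interval_extremal_points(5)[OF I]
    by (meson order_trans subsetD)
  moreover have "(\<exists>v\<in>I. z \<le> v + (\<epsilon>, \<epsilon>)) \<longleftrightarrow> (\<exists>v\<in>max_points I. z \<le> v + (\<epsilon>, \<epsilon>))"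
  proof -
    have "z \<le> v' + (\<epsilon>, \<epsilon>)" if "z \<le> v + (\<epsilon>, \<epsilon>)" "v \<le> v'" for v v'
      using that by (auto simp: less_eq_prod_def)
    then show ?thesis
      using pq_interval_bounds(2)[OF I] pq_interval_extremal_points(6)[OF I]
      by (meson subsetD)
  qed
  ultimately show ?thesis
    using mem_thickening_iff[of I \<epsilon> z] assms(2) by simp
qed

section \<open>The defects as an asymmetric distance\<close>

text \<open>
  The least \<open>\<epsilon> \<ge> 0\<close> such that lowering both coordinates of \<open>u\<close> by \<open>\<epsilon>\<close> brings it below \<open>v\<close>.
\<close>

definition excess :: "real \<times> real \<Rightarrow> real \<times> real \<Rightarrow> real" where
  "excess u v = max (max 0 (fst u - fst v)) (max 0 (snd u - snd v))"

lemma excess_le_iff: "\<epsilon> \<ge> 0 \<Longrightarrow> excess u v \<le> \<epsilon> \<longleftrightarrow> u \<le> v + (\<epsilon>, \<epsilon>)"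
  by (auto simp: excess_def less_eq_prod_def)

lemma excess_nonneg: "excess u v \<ge> 0"
  by (simp add: excess_def)

lemma min_defect_eq: "min_defect I v = (MIN u\<in>min_points I. excess u v)"
  unfolding min_defect_def excess_def \<delta>_def
  by (auto simp: case_prod_beta intro!: arg_cong[where f = Min] image_cong)

lemma max_defect_eq: "max_defect I v = (MIN u\<in>max_points I. excess v u)"
  unfolding max_defect_def excess_def \<delta>_def
  by (auto simp: case_prod_beta intro!: arg_cong[where f = Min] image_cong)

lemma F_eq_excess: "F w1 w2 w3 w4 = excess (w2, w4) (w1, w3)"
  by (simp add: F_def excess_def \<delta>_def)

text \<open>
  An arbitrary point of \<open>J\<close> inherits its lower condition from a minimal point below it and its
  upper condition from a maximal point above it. These two points may use unrelated points
  of \<open>I\<close>, which is harmless by \<open>mem_thickening_pq_interval_iff\<close>.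
\<close>

lemma subset_thickening_iff:
  assumes I: "pq_interval p q I" and J: "pq_interval p' q' J" and \<epsilon>: "\<epsilon> \<ge> 0"
  shows "J \<subseteq> thickening I \<epsilon> \<longleftrightarrow>
    (\<forall>v\<in>min_points J. min_defect I v \<le> \<epsilon>) \<and> (\<forall>v\<in>max_points J. max_defect I v \<le> \<epsilon>)"
proof -
  note fin = pq_interval_extremal_points[OF I]
  have min: "min_defect I v \<le> \<epsilon> \<longleftrightarrow> (\<exists>u\<in>min_points I. u \<le> v + (\<epsilon>, \<epsilon>))" for v
    unfolding min_defect_eq using fin \<epsilon> by (simp add: Min_le_iff excess_le_iff)
  have max: "max_defect I v \<le> \<epsilon> \<longleftrightarrow> (\<exists>u\<in>max_points I. v \<le> u + (\<epsilon>, \<epsilon>))" for v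
    unfolding max_defect_eq using fin \<epsilon> by (simp add: Min_le_iff excess_le_iff)
  have mono: "v + (\<epsilon>, \<epsilon>) \<le> w + (\<epsilon>, \<epsilon>)" if "v \<le> w" for v w :: "real \<times> real"
    using that by (auto simp: less_eq_prod_def)
  show ?thesis
    unfolding min max subset_iff mem_thickening_pq_interval_iff[OF I \<epsilon>]
    using pq_interval_bounds[OF J] pq_interval_extremal_points(5,6)[OF J] mono
    by (meson order_trans subsetD)
qed

lemma interval_eps_nonneg:
  assumes "pq_interval p q I" and J: "pq_interval p' q' J"
  shows "interval_eps I J \<ge> 0"
proof -
  note finI = pq_interval_extremal_points[OF assms(1)] and finJ = pq_interval_extremal_points[OF J]
  obtain v where v: "v \<in> min_points J" using finJ by blast
  have "0 \<le> min_defect I v"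
    unfolding min_defect_eq using finI by (simp add: Min_ge_iff excess_nonneg)
  also have "\<dots> \<le> (MAX v\<in>min_points J. min_defect I v)"
    using v finJ by simp
  also have "\<dots> \<le> interval_eps I J"
    unfolding interval_eps_def by (rule Max_ge) auto
  finally show ?thesis .
qed

lemma interval_eps_le_iff:
  assumes "pq_interval p q I" "pq_interval p' q' J" "\<epsilon> \<ge> 0"
  shows "interval_eps I J \<le> \<epsilon> \<longleftrightarrow> J \<subseteq> thickening I \<epsilon> \<and> I \<subseteq> thickening J \<epsilon>"
  unfolding interval_eps_def subset_thickening_iff[OF assms]
    subset_thickening_iff[OF assms(2,1,3)]
  using pq_interval_extremal_points[OF assms(1)] pq_interval_extremal_points[OF assms(2)]
  by auto

section \<open>The distance between finite families\<close>

text \<open>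
  The largest possible correspondence is the set of all pairs at cost at most \<open>\<epsilon>\<close>; only the
  surjectivity of its projections is in question.
\<close>

lemma eps_correspondence_iff:
  fixes n m :: nat
  assumes "n \<ge> 1" "m \<ge> 1" and \<epsilon>: "\<epsilon> > 0"
    and I: "\<And>r. r \<in> {1..n} \<Longrightarrow> pq_interval (p r) (q r) (I r)"
    and J: "\<And>s. s \<in> {1..m} \<Longrightarrow> pq_interval (p' s) (q' s) (J s)"
  shows "(\<exists>R. eps_correspondence \<epsilon> (I ` {1..n}) (J ` {1..m}) R) \<longleftrightarrow>
    max (MAX r\<in>{1..n}. MIN s\<in>{1..m}. interval_eps (I r) (J s))
        (MAX s\<in>{1..m}. MIN r\<in>{1..n}. interval_eps (I r) (J s)) \<le> \<epsilon>"
    (is "?L \<longleftrightarrow> ?R")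
proof -
  have close: "interval_eps (I r) (J s) \<le> \<epsilon> \<longleftrightarrow>
      J s \<subseteq> thickening (I r) \<epsilon> \<and> I r \<subseteq> thickening (J s) \<epsilon>"
    if "r \<in> {1..n}" "s \<in> {1..m}" for r s
    using interval_eps_le_iff[OF I[OF that(1)] J[OF that(2)]] \<epsilon> by simp
  have R: "?R \<longleftrightarrow>
      (\<forall>r\<in>{1..n}. \<exists>s\<in>{1..m}. interval_eps (I r) (J s) \<le> \<epsilon>) \<and>
      (\<forall>s\<in>{1..m}. \<exists>r\<in>{1..n}. interval_eps (I r) (J s) \<le> \<epsilon>)"
    using assms(1,2) by (simp add: Min_le_iff)
  show ?thesis
    unfolding R
  proof
    assume ?L
    then obtain R where "eps_correspondence \<epsilon> (I ` {1..n}) (J ` {1..m}) R" by blast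
    then have sub: "R \<subseteq> I ` {1..n} \<times> J ` {1..m}"
      and fst: "fst ` R = I ` {1..n}" and snd: "snd ` R = J ` {1..m}"
      and thick: "\<And>K L. (K, L) \<in> R \<Longrightarrow> L \<subseteq> thickening K \<epsilon> \<and> K \<subseteq> thickening L \<epsilon>"
      unfolding eps_correspondence_def by auto
    have "\<exists>s\<in>{1..m}. interval_eps (I r) (J s) \<le> \<epsilon>" if r: "r \<in> {1..n}" for r
    proof -
      obtain L where L: "(I r, L) \<in> R" using fst r by force
      then obtain s where "s \<in> {1..m}" "L = J s" using sub by blast
      then show ?thesis using close[OF r] thick[OF L] by blast
    qed
    moreover have "\<exists>r\<in>{1..n}. interval_eps (I r) (J s) \<le> \<epsilon>" if s: "s \<in> {1..m}" for s
    proof -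
      obtain K where K: "(K, J s) \<in> R" using snd s by force
      then obtain r where "r \<in> {1..n}" "K = I r" using sub by blast
      then show ?thesis using close[OF _ s] thick[OF K] by blast
    qed
    ultimately show "(\<forall>r\<in>{1..n}. \<exists>s\<in>{1..m}. interval_eps (I r) (J s) \<le> \<epsilon>) \<and>
      (\<forall>s\<in>{1..m}. \<exists>r\<in>{1..n}. interval_eps (I r) (J s) \<le> \<epsilon>)" by blast
  next
    assume cover: "(\<forall>r\<in>{1..n}. \<exists>s\<in>{1..m}. interval_eps (I r) (J s) \<le> \<epsilon>) \<and>
      (\<forall>s\<in>{1..m}. \<exists>r\<in>{1..n}. interval_eps (I r) (J s) \<le> \<epsilon>)"
    define R where
      "R = {(I r, J s) | r s. r \<in> {1..n} \<and> s \<in> {1..m} \<and> interval_eps (I r) (J s) \<le> \<epsilon>}"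
    have "fst ` R = I ` {1..n}"
    proof (intro equalityI subsetI)
      fix K assume "K \<in> I ` {1..n}"
      then obtain r s where "K = I r" "(I r, J s) \<in> R" using cover unfolding R_def by blast
      then show "K \<in> fst ` R" by force
    qed (auto simp: R_def)
    moreover have "snd ` R = J ` {1..m}"
    proof (intro equalityI subsetI)
      fix K assume "K \<in> J ` {1..m}"
      then obtain r s where "K = J s" "(I r, J s) \<in> R" using cover unfolding R_def by blast
      then show "K \<in> snd ` R" by force
    qed (auto simp: R_def)
    moreover have "R \<subseteq> I ` {1..n} \<times> J ` {1..m}" unfolding R_def by blast
    moreover have "\<forall>(K, L)\<in>R. L \<subseteq> thickening K \<epsilon> \<and> K \<subseteq> thickening L \<epsilon>"
      using close unfolding R_def by auto
    ultimately have "eps_correspondence \<epsilon> (I ` {1..n}) (J ` {1..m}) R"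
      unfolding eps_correspondence_def by (intro conjI)
    then show ?L by blast
  qed
qed

lemma INF_ereal_pos_ge:
  fixes M :: real
  assumes "M \<ge> 0"
  shows "(INF \<epsilon>\<in>{\<epsilon>. \<epsilon> > 0 \<and> M \<le> \<epsilon>}. ereal \<epsilon>) = ereal M"
proof (rule antisym)
  show "(INF \<epsilon>\<in>{\<epsilon>. \<epsilon> > 0 \<and> M \<le> \<epsilon>}. ereal \<epsilon>) \<le> ereal M"
  proof (rule ereal_le_epsilon2)
    fix e :: real assume "0 < e"
    then have "(INF \<epsilon>\<in>{\<epsilon>. \<epsilon> > 0 \<and> M \<le> \<epsilon>}. ereal \<epsilon>) \<le> ereal (M + e)"
      using assms by (intro INF_lower) auto
    then show "(INF \<epsilon>\<in>{\<epsilon>. \<epsilon> > 0 \<and> M \<le> \<epsilon>}. ereal \<epsilon>) \<le> ereal M + ereal e" by simp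
  qed
qed (auto intro: INF_greatest)

lemma d_hat_eq:
  fixes n m :: nat
  assumes "n \<ge> 1" "m \<ge> 1"
    and I: "\<And>r. r \<in> {1..n} \<Longrightarrow> pq_interval (p r) (q r) (I r)"
    and J: "\<And>s. s \<in> {1..m} \<Longrightarrow> pq_interval (p' s) (q' s) (J s)"
  shows "d_hat (I ` {1..n}) (J ` {1..m}) = ereal (max
    (MAX r\<in>{1..n}. MIN s\<in>{1..m}. interval_eps (I r) (J s))
    (MAX s\<in>{1..m}. MIN r\<in>{1..n}. interval_eps (I r) (J s)))" (is "_ = ereal ?M")
proof -
  have "0 \<le> (MIN s\<in>{1..m}. interval_eps (I 1) (J s))"
    using assms(1,2) interval_eps_nonneg[OF I J] by (intro Min.boundedI) auto
  also have "\<dots> \<le> (MAX r\<in>{1..n}. MIN s\<in>{1..m}. interval_eps (I r) (J s))"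
    using assms(1) by (intro Max_ge) auto
  also have "\<dots> \<le> ?M" by simp
  finally have M: "0 \<le> ?M" .
  have "{\<epsilon>. \<epsilon> > 0 \<and> (\<exists>R. eps_correspondence \<epsilon> (I ` {1..n}) (J ` {1..m}) R)} =
      {\<epsilon>. \<epsilon> > 0 \<and> ?M \<le> \<epsilon>}"
    by (intro Collect_cong conj_cong refl eps_correspondence_iff[OF assms(1,2) _ I J])
  then show ?thesis
    unfolding d_hat_def using INF_ereal_pos_ge[OF M] by simp
qed

section \<open>Intervals with one or two minimal points and one maximal point\<close>

text \<open>
  A single minimal point is listed twice, so that both kinds of intervals are covered at once.
\<close>

lemma has_params_points:
  assumes "has_params I x y a b c d"
  shows "min_points I = {(x - b, y), (x, y - c)}" "max_points I = {(x + d, y + a)}"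
  using assms by (cases, auto)+

lemma interval_eps_params:
  assumes "has_params I x1 y1 a b c d" "has_params J x2 y2 e f g h"
  shows "interval_eps I J = Max {
    H (F (x2 - f) (x1 - b) y2 y1) (F (x2 - f) x1 y2 (y1 - c))
      (F x2 (x1 - b) (y2 - g) y1) (F x2 x1 (y2 - g) (y1 - c)),
    F (x1 + d) (x2 + h) (y1 + a) (y2 + e),
    H (F (x1 - b) (x2 - f) y1 y2) (F (x1 - b) x2 y1 (y2 - g))
      (F x1 (x2 - f) (y1 - c) y2) (F x1 x2 (y1 - c) (y2 - g)),
    F (x2 + h) (x1 + d) (y2 + e) (y1 + a)}"
proof -
  have two: "Min {p, q} = min p q" "Max {p, q} = max p q" for p q :: real
    by simp_all
  show ?thesis
    by (simp only: interval_eps_def min_defect_eq max_defect_eq F_eq_excess H_def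
        has_params_points[OF assms(1)] has_params_points[OF assms(2)]
        image_insert image_empty two Min_singleton Max_singleton)
qed

theorem theorem9:
  fixes n m :: nat
    and I J :: "nat \<Rightarrow> (real \<times> real) set"
    and p q p' q' :: "nat \<Rightarrow> nat"
  assumes "n \<ge> 1" and "m \<ge> 1"
    and "\<And>r. r \<in> {1..n} \<Longrightarrow> p r > 0 \<and> q r > 0 \<and> pq_interval (p r) (q r) (I r)"
    and "\<And>s. s \<in> {1..m} \<Longrightarrow> p' s > 0 \<and> q' s > 0 \<and> pq_interval (p' s) (q' s) (J s)"
  shows "(d_hat (I ` {1..n}) (J ` {1..m}) = ereal (max
           (MAX r\<in>{1..n}. MIN s\<in>{1..m}. interval_eps (I r) (J s))
           (MAX s\<in>{1..m}. MIN r\<in>{1..n}. interval_eps (I r) (J s)))) \<and>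
         ((\<forall>K \<in> I ` {1..n} \<union> J ` {1..m}. pq_interval 1 1 K \<or> pq_interval 2 1 K) \<longrightarrow>
         (\<forall>r\<in>{1..n}. \<forall>s\<in>{1..m}. \<forall>x1 y1 a b c d x2 y2 e f g h.
           has_params (I r) x1 y1 a b c d \<and> has_params (J s) x2 y2 e f g h \<longrightarrow>
           interval_eps (I r) (J s) = Max {
             H (F (x2 - f) (x1 - b) y2 y1) (F (x2 - f) x1 y2 (y1 - c))
               (F x2 (x1 - b) (y2 - g) y1) (F x2 x1 (y2 - g) (y1 - c)),
             F (x1 + d) (x2 + h) (y1 + a) (y2 + e),
             H (F (x1 - b) (x2 - f) y1 y2) (F (x1 - b) x2 y1 (y2 - g))
               (F x1 (x2 - f) (y1 - c) y2) (F x1 x2 (y1 - c) (y2 - g)),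
             F (x2 + h) (x1 + d) (y2 + e) (y1 + a)}))"
proof (intro conjI)
  show "d_hat (I ` {1..n}) (J ` {1..m}) = ereal (max
      (MAX r\<in>{1..n}. MIN s\<in>{1..m}. interval_eps (I r) (J s))
      (MAX s\<in>{1..m}. MIN r\<in>{1..n}. interval_eps (I r) (J s)))"
    using assms by (intro d_hat_eq[of n m p q I p' q' J]) simp_all
qed (intro impI ballI allI, elim conjE, rule interval_eps_params)

end
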